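(* Let $G = \sum_{n=0}^\infty \frac{(-1)^n}{(2n+1)^2}$ denote Catalan's constant. Then $$G = \frac12 \sum_{n=0}^\infty (-1)^n \, \frac{(3n+2)\, 8^n}{(2n+1)^3 \binom{2n}{n}^3}.$$
   Context: $\binom{2n}{n}$ denotes the central binomial coefficient. *)

theory Defs
  imports "HOL-Analysis.Analysis"
begin

definition catalan_constant :: real where
  "catalan_constant = (\<Sum>n. (-1) ^ n / (2 * real n + 1) ^ 2)"

text \<open>The defining series converges, so the infinite sum above is a genuine one and
  not the arbitrary value that suminf takes on a divergent series.\<close>

lemma catalan_constant_sums:
  "(\<lambda>n. (-1) ^ n / (2 * real n + 1) ^ 2) sums catalan_constant"
proof -
  have "summable (\<lambda>n. inverse (real (Suc n) ^ 2))"
    using inverse_power_summable[of 2, where 'a = real] by (subst summable_Suc_iff) simp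
  moreover have "norm ((-1) ^ n / (2 * real n + 1) ^ 2) \<le> inverse (real (Suc n) ^ 2)" for n
  proof -
    have "1 / (2 * real n + 1) ^ 2 \<le> 1 / real (Suc n) ^ 2"
      by (rule divide_left_mono[OF power_mono]) simp_all
    then show ?thesis
      by (simp add: norm_divide norm_power inverse_eq_divide)
  qed
  ultimately have "summable (\<lambda>n. (-1) ^ n / (2 * real n + 1) ^ 2)"
    by (rule summable_comparison_test'[where N = 0])
  then show ?thesis
    unfolding catalan_constant_def by (rule summable_sums)
qed

end

theory Submission
  imports Defs
begin

text \<open>Two Wilf--Zeilberger pairs, both anchored at the slowly convergent series
  \<open>\<Sum>k. r k / (2 k + 1)\<close> with \<open>r k = k! / (3/2)\<^sub>k\<close>. The first pair
  comes from inserting a parameter \<open>k\<close> in the series of the theorem (a quadratic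
  summation formula with argument \<open>-1/8\<close>, with the index shifted by \<open>1/2\<close>) and shows that
  the two sums agree. The second pair is Whipple's transformation of a well-poised series with
  argument \<open>-1\<close> to a \<open>3F2\<close> with argument \<open>1\<close>, applied to the tails
  of the slow series; it shows that the slow series has the value \<open>2 G\<close>.\<close>

section \<open>Summation along two edges of a Wilf-Zeilberger pair\<close>

text \<open>Summing \<open>step\<close> over \<open>n\<close> telescopes the right-hand side, and
  summing the result over \<open>k\<close> telescopes the left. The product bound does double duty:
  its factor \<open>s n\<close> makes every sum over \<open>n\<close> converge, and its factor
  \<open>e k\<close> forces these sums to vanish as \<open>k\<close> grows, so no double series has
  to be rearranged.\<close>

lemma WZ_sums:
  fixes f g :: "nat \<Rightarrow> nat \<Rightarrow> real"
  assumes step: "\<And>n k. g n k - g n (Suc k) = f n k - f (Suc n) k"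
    and f_lim: "\<And>k. (\<lambda>n. f n k) \<longlonglongrightarrow> 0"
    and bound: "\<And>n k. \<bar>g n k\<bar> \<le> e k * s n"
    and s: "summable s" and e: "e \<longlonglongrightarrow> 0"
  shows "summable (\<lambda>n. g n 0)" "f 0 sums (\<Sum>n. g n 0)"
proof -
  have summ: "summable (\<lambda>n. g n k)" for k
    by (rule summable_comparison_test'[where N = 0, OF summable_mult[OF s, of "e k"]])
       (use bound in auto)
  then show "summable (\<lambda>n. g n 0)" .
  define S where "S k = (\<Sum>n. g n k)" for k
  have S_step: "S k - S (Suc k) = f 0 k" for k
  proof -
    have "(\<lambda>n. f n k - f (Suc n) k) sums (f 0 k - 0)"
      by (rule telescope_sums'[OF f_lim])
    moreover have "(\<lambda>n. f n k - f (Suc n) k) sums (S k - S (Suc k))"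
      unfolding S_def step[symmetric] by (intro sums_diff summable_sums summ)
    ultimately show ?thesis
      using sums_unique2 by fastforce
  qed
  \<comment> \<open>Without this the telescoped sum over \<open>k\<close> would retain the boundary
    term at infinity.\<close>
  have "S \<longlonglongrightarrow> 0"
  proof (rule Lim_null_comparison)
    show "\<forall>\<^sub>F k in sequentially. norm (S k) \<le> e k * suminf s"
    proof (intro always_eventually allI)
      fix k
      have "norm (S k) \<le> (\<Sum>n. e k * s n)"
        unfolding S_def by (rule norm_suminf_le) (use bound summable_mult[OF s] in auto)
      then show "norm (S k) \<le> e k * suminf s"
        by (simp add: suminf_mult[OF s])
    qed
    show "(\<lambda>k. e k * suminf s) \<longlonglongrightarrow> 0"
      using tendsto_mult_right[OF e, of "suminf s"] by simp
  qed
  from telescope_sums'[OF this] have "f 0 sums S 0"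
    by (simp add: S_step)
  then show "f 0 sums (\<Sum>n. g n 0)"
    by (simp add: S_def)
qed

section \<open>The Pochhammer ratio \<open>r\<close> and central binomial coefficients\<close>

definition r :: "nat \<Rightarrow> real" where
  "r n = fact n / pochhammer (3/2) n"

lemma r_Suc: "r (Suc n) = r n * (2 * real n + 2) / (2 * real n + 3)"
  by (simp add: r_def pochhammer_Suc field_simps)

lemma r_pos: "r n > 0"
  by (simp add: r_def pochhammer_pos)

text \<open>The decay is of order n^(-1/2). Squaring avoids roots, and the induction step comes down
  to 4(n+1)(n+2) <= (2n+3)^2.\<close>

lemma r_square_le: "(r n)\<^sup>2 \<le> 1 / (real n + 1)"
proof (induction n)
  case 0
  show ?case by (simp add: r_def)
next
  case (Suc n)
  have "(r (Suc n))\<^sup>2 = (r n)\<^sup>2 * ((2 * real n + 2) / (2 * real n + 3))\<^sup>2"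
    by (simp add: r_Suc power_mult_distrib power_divide)
  also have "\<dots> \<le> 1 / (real n + 1) * ((2 * real n + 2) / (2 * real n + 3))\<^sup>2"
    by (intro mult_right_mono Suc.IH) auto
  also have "\<dots> \<le> 1 / (real (Suc n) + 1)"
    by (simp add: divide_simps power2_eq_square) (simp add: algebra_simps)
  finally show ?case .
qed

lemma r_tendsto_0: "r \<longlonglongrightarrow> 0"
proof -
  have "(\<lambda>n. (r n)\<^sup>2) \<longlonglongrightarrow> 0"
  proof (rule Lim_null_comparison)
    show "\<forall>\<^sub>F n in sequentially. norm ((r n)\<^sup>2) \<le> 1 / (real n + 1)"
      using r_square_le by simp
    show "(\<lambda>n. 1 / (real n + 1)) \<longlonglongrightarrow> 0"
      using LIMSEQ_inverse_real_of_nat by (simp add: inverse_eq_divide add.commute)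
  qed
  then show ?thesis by simp
qed

lemma central_binomial_Suc:
  "real (Suc n) * real (2 * Suc n choose Suc n) = 2 * (2 * real n + 1) * real (2 * n choose n)"
proof -
  have choose: "real (2 * m choose m) = fact (2 * m) / (fact m)\<^sup>2" for m
    by (simp add: binomial_fact power2_eq_square)
  show ?thesis
    unfolding choose by (simp add: divide_simps power2_eq_square) (simp add: algebra_simps)
qed

text \<open>Links the binomials of the theorem to Pochhammer symbols: the summand becomes (3n+2)
  (-1/8)^n \<open>r n\<close>^3.\<close>

lemma r_central_binomial: "r n = 4 ^ n / ((2 * real n + 1) * real (2 * n choose n))"
proof (induction n)
  case 0
  show ?case by (simp add: r_def)
next
  case (Suc n)
  define c where "c = real (2 * n choose n)"
  have "c > 0" by (simp add: c_def)
  have c_Suc: "real (2 * Suc n choose Suc n) = 2 * (2 * real n + 1) * c / real (Suc n)"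
    using central_binomial_Suc[of n] by (simp add: c_def field_simps del: binomial_Suc_Suc)
  show ?case
    unfolding r_Suc Suc.IH c_Suc c_def[symmetric] using \<open>c > 0\<close>
    by (simp add: divide_simps) (simp add: algebra_simps)
qed

section \<open>First pair: from the cubic series to the slow series\<close>

text \<open>The edge \<open>k = 0\<close> carries the cube of \<open>r\<close>. On the edge
  \<open>n = 0\<close>, (2k)!/4^k = k! (1/2)_k, so one quotient (1/2)_k/(3/2)_k collapses to
  1/(2k+1) and a single \<open>r k\<close> remains.\<close>

definition B :: "nat \<Rightarrow> nat \<Rightarrow> real" where
  "B n k = (-1/8) ^ n * (1/4) ^ k * fact (n + 2 * k) * (fact n)\<^sup>2
     / (pochhammer (3/2) n * (pochhammer (3/2) (n + k))\<^sup>2)"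

lemma B_Suc_left:
  "B (Suc n) k = B n k * (- ((real n + 2 * real k + 1) * (real n + 1)\<^sup>2)
     / ((2 * real n + 3) * (2 * real n + 2 * real k + 3)\<^sup>2))"
proof -
  have "B (Suc n) k = B n k * ((-1/8) * (real n + 2 * real k + 1) * (real n + 1)\<^sup>2
      / ((3/2 + real n) * (3/2 + real (n + k))\<^sup>2))"
    by (simp add: B_def pochhammer_Suc power_mult_distrib add_ac mult_ac)
  also have "(-1/8) * (real n + 2 * real k + 1) * (real n + 1)\<^sup>2
      / ((3/2 + real n) * (3/2 + real (n + k))\<^sup>2)
    = - ((real n + 2 * real k + 1) * (real n + 1)\<^sup>2)
     / ((2 * real n + 3) * (2 * real n + 2 * real k + 3)\<^sup>2)"
    by (simp add: divide_simps power2_eq_square) (simp add: algebra_simps)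
  finally show ?thesis by simp
qed

lemma B_Suc_right:
  "B n (Suc k) = B n k * ((real n + 2 * real k + 1) * (real n + 2 * real k + 2)
     / (2 * real n + 2 * real k + 3)\<^sup>2)"
proof -
  have "B n (Suc k) = B n k * ((1/4) * (real n + 2 * real k + 1) * (real n + 2 * real k + 2)
      / (3/2 + real (n + k))\<^sup>2)"
    by (simp add: B_def pochhammer_Suc power_mult_distrib add_ac mult_ac)
  also have "(1/4) * (real n + 2 * real k + 1) * (real n + 2 * real k + 2)
      / (3/2 + real (n + k))\<^sup>2
    = (real n + 2 * real k + 1) * (real n + 2 * real k + 2) / (2 * real n + 2 * real k + 3)\<^sup>2"
    by (simp add: divide_simps power2_eq_square) (simp add: algebra_simps)
  finally show ?thesis by simp
qed

text \<open>The linear multipliers are the WZ certificate. Both shifts of \<open>B\<close> are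
  rational multiples of \<open>B n k\<close>, so only an identity of rational functions has to be
  checked.\<close>

lemma B_WZ:
  "(3 * real n + 2 * real k + 2) * B n k - (3 * real n + 2 * real (Suc k) + 2) * B n (Suc k)
   = (2 * real n + 1) * B n k - (2 * real (Suc n) + 1) * B (Suc n) k"
proof -
  define x y where "x = real n" and "y = real k"
  have nz: "2 * x + 3 \<noteq> 0" "2 * x + 2 * y + 3 \<noteq> 0"
    by (auto simp: x_def y_def)
  define p q where "p = - ((x + 2 * y + 1) * (x + 1)\<^sup>2) / ((2 * x + 3) * (2 * x + 2 * y + 3)\<^sup>2)"
    and "q = (x + 2 * y + 1) * (x + 2 * y + 2) / (2 * x + 2 * y + 3)\<^sup>2"
  \<comment> \<open>The multiplier at \<open>Suc n\<close> cancels this factor of \<open>p\<close>,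
    leaving (2x+2y+3)^2 as the only denominator.\<close>
  have "(2 * x + 3) * p = - ((x + 2 * y + 1) * (x + 1)\<^sup>2) / (2 * x + 2 * y + 3)\<^sup>2"
    using nz by (simp add: p_def)
  moreover have "(3 * x + 2 * y + 2) - (3 * x + 2 * y + 4) * q
      = (2 * x + 1) - (- ((x + 2 * y + 1) * (x + 1)\<^sup>2) / (2 * x + 2 * y + 3)\<^sup>2)"
    unfolding q_def using nz by (simp add: divide_simps) (simp add: algebra_simps power2_eq_square)
  ultimately have "(3 * x + 2 * y + 2) - (3 * x + 2 * y + 4) * q = (2 * x + 1) - (2 * x + 3) * p"
    by simp
  from arg_cong[OF this, of "\<lambda>z. B n k * z"] show ?thesis
    unfolding B_Suc_left B_Suc_right x_def[symmetric] y_def[symmetric]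
      p_def[symmetric] q_def[symmetric]
    by (simp add: x_def y_def algebra_simps)
qed

lemma B_0_right: "B n 0 = (-1/8) ^ n * r n ^ 3"
  by (simp add: B_def r_def power3_eq_cube power2_eq_square)

lemma B_0_left: "B 0 k = r k / (2 * real k + 1)"
proof (induction k)
  case 0
  show ?case by (simp add: B_def r_def)
next
  case (Suc k)
  show ?case
    unfolding B_Suc_right Suc.IH r_Suc
    by (simp add: divide_simps) (simp add: algebra_simps power2_eq_square)
qed

lemma abs_B_le: "\<bar>B n k\<bar> \<le> (1/4) ^ n * B 0 k"
proof (induction n)
  case 0
  show ?case using r_pos[of k] by (simp add: B_0_left)
next
  case (Suc n)
  define x y where "x = real n" and "y = real k"
  have xy: "x \<ge> 0" "y \<ge> 0" by (auto simp: x_def y_def)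
  \<comment> \<open>Once the 4 is absorbed into the two factors x+1, the three factors are dominated
    one by one. The ratio 1/4 is therefore uniform in \<open>k\<close>.\<close>
  have "4 * ((x + 2 * y + 1) * ((x + 1) * (x + 1))) = (x + 2 * y + 1) * ((2 * x + 2) * (2 * x + 2))"
    by (simp add: algebra_simps)
  also have "\<dots> \<le> (2 * x + 2 * y + 3) * ((2 * x + 3) * (2 * x + 2 * y + 3))"
    using xy by (intro mult_mono) auto
  finally have le: "(x + 2 * y + 1) * (x + 1)\<^sup>2 / ((2 * x + 3) * (2 * x + 2 * y + 3)\<^sup>2) \<le> 1/4"
    using xy by (simp add: divide_simps power2_eq_square mult_ac)
  have "\<bar>B (Suc n) k\<bar>
      = \<bar>B n k\<bar> * ((x + 2 * y + 1) * (x + 1)\<^sup>2 / ((2 * x + 3) * (2 * x + 2 * y + 3)\<^sup>2))"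
    using xy by (simp add: B_Suc_left x_def y_def abs_mult)
  also have "\<dots> \<le> ((1/4) ^ n * B 0 k) * (1/4)"
    using Suc.IH le xy by (intro mult_mono) (auto intro: order_trans[OF abs_ge_zero])
  finally show ?case by simp
qed

lemma linear_le_exp: "3 * real n + 2 \<le> 4 * 2 ^ n"
  by (induction n) (simp_all, smt (verit) one_le_power)

text \<open>Leaving \<open>c\<close> open covers the multipliers of both members of the pair. The
  linear growth in \<open>n\<close> is paid for by weakening 4^(-n) to 2^(-n).\<close>

lemma abs_B_mult_le:
  assumes "0 \<le> c" "c \<le> 3 * real n + 2 * real k + 2"
  shows "\<bar>c * B n k\<bar> \<le> r k * (4 * (1/2) ^ n)"
proof -
  have "\<bar>c * B n k\<bar> \<le> (3 * real n + 2 * real k + 2) * ((1/4) ^ n * B 0 k)"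
    unfolding abs_mult using assms abs_B_le by (intro mult_mono) auto
  \<comment> \<open>Separates the variables; the factor 2k+1 then cancels the denominator of
    \<open>B 0 k\<close>.\<close>
  also have "\<dots> \<le> ((3 * real n + 2) * (2 * real k + 1)) * ((1/4) ^ n * B 0 k)"
    using r_pos[of k] by (intro mult_right_mono) (auto simp: B_0_left algebra_simps)
  also have "\<dots> = (3 * real n + 2) * ((1/4) ^ n * r k)"
    by (simp add: B_0_left)
  also have "\<dots> \<le> (4 * 2 ^ n) * ((1/4) ^ n * r k)"
    using r_pos[of k] linear_le_exp by (intro mult_right_mono) auto
  also have "\<dots> = r k * (4 * (2 * (1/4)) ^ n)"
    unfolding power_mult_distrib by simp
  finally show ?thesis by simp
qed

lemma summable_half_powers: "summable (\<lambda>n. 4 * (1/2::real) ^ n)"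
  by (intro summable_mult summable_geometric) simp

lemma B_sums:
  shows "summable (\<lambda>n. (3 * real n + 2) * B n 0)"
    and "(\<lambda>k. r k / (2 * real k + 1)) sums (\<Sum>n. (3 * real n + 2) * B n 0)"
proof -
  have lim: "(\<lambda>n. (2 * real n + 1) * B n k) \<longlonglongrightarrow> 0" for k
  proof (rule Lim_null_comparison)
    show "\<forall>\<^sub>F n in sequentially. norm ((2 * real n + 1) * B n k) \<le> r k * (4 * (1/2) ^ n)"
      unfolding real_norm_def by (intro always_eventually allI abs_B_mult_le) auto
    show "(\<lambda>n. r k * (4 * (1/2) ^ n)) \<longlonglongrightarrow> 0"
      by (intro tendsto_mult_right_zero summable_LIMSEQ_zero summable_half_powers)
  qed
  have bound: "\<bar>(3 * real n + 2 * real k + 2) * B n k\<bar> \<le> r k * (4 * (1/2) ^ n)" for n k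
    by (rule abs_B_mult_le) auto
  note WZ = WZ_sums[of "\<lambda>n k. (3 * real n + 2 * real k + 2) * B n k"
      "\<lambda>n k. (2 * real n + 1) * B n k", OF B_WZ lim bound summable_half_powers r_tendsto_0]
  show "summable (\<lambda>n. (3 * real n + 2) * B n 0)"
    using WZ(1) by simp
  show "(\<lambda>k. r k / (2 * real k + 1)) sums (\<Sum>n. (3 * real n + 2) * B n 0)"
    using WZ(2) by (simp add: B_0_left)
qed

section \<open>Second pair: from the slow series to Catalan's constant\<close>

text \<open>Interpolates between the two series: \<open>j = 0\<close> gives \<open>r n\<close>,
  while at \<open>n = 0\<close> the quotient (1/2)_j/(3/2)_j collapses to 1/(2j+1).\<close>

definition V :: "nat \<Rightarrow> nat \<Rightarrow> real" where
  "V j n = (-1) ^ j * fact n * pochhammer (1/2) j / pochhammer (3/2) (n + j)"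

lemma V_Suc_right: "V j (Suc n) = V j n * (2 * (real n + 1) / (2 * real n + 2 * real j + 3))"
proof -
  have "V j (Suc n) = V j n * ((real n + 1) / (3/2 + real (n + j)))"
    by (simp add: V_def pochhammer_Suc mult_ac add_ac)
  then show ?thesis by (simp add: field_simps)
qed

lemma V_Suc_left: "V (Suc j) n = - V j n * ((2 * real j + 1) / (2 * real n + 2 * real j + 3))"
proof -
  have "V (Suc j) n = - V j n * ((1/2 + real j) / (3/2 + real (n + j)))"
    by (simp add: V_def pochhammer_Suc mult_ac)
  also have "(1/2 + real j) / (3/2 + real (n + j)) = (2 * real j + 1) / (2 * real n + 2 * real j + 3)"
    by (simp add: divide_simps) (simp add: algebra_simps)
  finally show ?thesis .
qed

lemma V_WZ:
  defines "W \<equiv> \<lambda>j n. (real n + 2 * real j + 1) / ((2 * real n + 2 * real j + 1) * (2 * real j + 1)) * V j n"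
    and "H \<equiv> \<lambda>j n. 1 / (2 * (2 * real n + 2 * real j + 1)) * V j n"
  shows "W j n - W j (Suc n) = H j n - H (Suc j) n"
proof -
  define x y where "x = real n" and "y = real j"
  have nz: "2 * x + 2 * y + 1 \<noteq> 0" "2 * x + 2 * y + 3 \<noteq> 0" "2 * y + 1 \<noteq> 0"
    by (auto simp: x_def y_def)
  define a b c d where "a = (x + 2 * y + 1) / ((2 * x + 2 * y + 1) * (2 * y + 1))"
    and "b = (x + 2 * y + 2) / ((2 * x + 2 * y + 3) * (2 * y + 1))"
    and "c = 1 / (2 * (2 * x + 2 * y + 1))" and "d = 1 / (2 * (2 * x + 2 * y + 3))"
  define p q where "p = 2 * (x + 1) / (2 * x + 2 * y + 3)" and "q = (2 * y + 1) / (2 * x + 2 * y + 3)"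
  \<comment> \<open>The identity to be shown, divided by \<open>V j n\<close>. The plus sign arises
    because \<open>V\<close> alternates in \<open>j\<close>.\<close>
  have "a - b * p = c + d * q"
    unfolding a_def b_def c_def d_def p_def q_def
    using nz by (simp add: divide_simps) (simp add: algebra_simps)
  moreover have "W j n = a * V j n" "H j n = c * V j n"
    by (simp_all add: W_def H_def a_def c_def x_def y_def)
  moreover have "W j (Suc n) = b * (V j n * p)"
    unfolding W_def V_Suc_right by (simp add: b_def p_def x_def y_def add_ac)
  moreover have "H (Suc j) n = d * (- V j n * q)"
    unfolding H_def V_Suc_left by (simp add: d_def q_def x_def y_def add_ac)
  ultimately show ?thesis
    using arg_cong[of "a - b * p" "c + d * q" "\<lambda>z. z * V j n"] by (simp add: algebra_simps)
qed

lemma V_0_left: "V 0 n = r n"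
  by (simp add: V_def r_def)

lemma V_0_right: "V j 0 = (-1) ^ j / (2 * real j + 1)"
proof (induction j)
  case 0
  show ?case by (simp add: V_def)
next
  case (Suc j)
  show ?case
    unfolding V_Suc_left Suc.IH by (simp add: divide_simps)
qed

text \<open>Dropping 2n from the denominator of the ratio in \<open>j\<close> leaves a product that
  telescopes.\<close>

lemma abs_V_le: "\<bar>V j n\<bar> \<le> r n / (2 * real j + 1)"
proof (induction j)
  case 0
  show ?case using r_pos[of n] by (simp add: V_0_left)
next
  case (Suc j)
  have "\<bar>V (Suc j) n\<bar> = \<bar>V j n\<bar> * ((2 * real j + 1) / (2 * real n + 2 * real j + 3))"
    by (simp add: V_Suc_left abs_mult)
  also have "\<dots> \<le> r n / (2 * real j + 1) * ((2 * real j + 1) / (2 * real j + 3))"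
    using Suc.IH r_pos[of n] by (intro mult_mono divide_left_mono) auto
  also have "\<dots> = r n / (2 * real (Suc j) + 1)"
    by (simp add: divide_simps)
  finally show ?case .
qed

lemma summable_inverse_odd_squares: "summable (\<lambda>j. 1 / (2 * real j + 1)\<^sup>2)"
proof (rule summable_comparison_test'[where N = 0])
  show "summable (\<lambda>j. inverse (real (Suc j) ^ 2))"
    using inverse_power_summable[of 2, where 'a = real] by (subst summable_Suc_iff) simp
  show "norm (1 / (2 * real j + 1)\<^sup>2) \<le> inverse (real (Suc j) ^ 2)" for j
    unfolding inverse_eq_divide by (simp add: divide_left_mono power_mono)
qed

lemma catalan_constant_sums_r: "(\<lambda>n. r n / (2 * (2 * real n + 1))) sums catalan_constant"
proof -
  have bound: "\<bar>(real n + 2 * real j + 1) / ((2 * real n + 2 * real j + 1) * (2 * real j + 1)) * V j n\<bar>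
      \<le> r n * (1 / (2 * real j + 1)\<^sup>2)" for j n
  proof -
    \<comment> \<open>One factor 1/(2j+1) comes from the multiplier and another from
      \<open>abs_V_le\<close>, giving the summable square.\<close>
    have "(real n + 2 * real j + 1) / ((2 * real n + 2 * real j + 1) * (2 * real j + 1))
        \<le> 1 / (2 * real j + 1)"
      by (simp add: divide_simps)
    then have "\<bar>(real n + 2 * real j + 1) / ((2 * real n + 2 * real j + 1) * (2 * real j + 1)) * V j n\<bar>
        \<le> 1 / (2 * real j + 1) * (r n / (2 * real j + 1))"
      unfolding abs_mult using abs_V_le by (intro mult_mono) auto
    then show ?thesis by (simp add: power2_eq_square)
  qed
  have lim: "(\<lambda>j. 1 / (2 * (2 * real n + 2 * real j + 1)) * V j n) \<longlonglongrightarrow> 0" for n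
  proof (rule Lim_null_comparison)
    show "\<forall>\<^sub>F j in sequentially. norm (1 / (2 * (2 * real n + 2 * real j + 1)) * V j n)
        \<le> r n * (1 / (2 * real j + 1)\<^sup>2)"
    proof (intro always_eventually allI)
      fix j
      have "norm (1 / (2 * (2 * real n + 2 * real j + 1)) * V j n)
          \<le> 1 / (2 * real j + 1) * (r n / (2 * real j + 1))"
        unfolding real_norm_def abs_mult using abs_V_le
        by (intro mult_mono) (auto intro!: divide_left_mono)
      then show "norm (1 / (2 * (2 * real n + 2 * real j + 1)) * V j n)
          \<le> r n * (1 / (2 * real j + 1)\<^sup>2)"
        by (simp add: power2_eq_square)
    qed
    show "(\<lambda>j. r n * (1 / (2 * real j + 1)\<^sup>2)) \<longlonglongrightarrow> 0"
      by (intro tendsto_mult_right_zero summable_LIMSEQ_zero summable_inverse_odd_squares)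
  qed
  \<comment> \<open>Here \<open>j\<close> is the inner summation index and \<open>n\<close> the
    outer one. The 1/2 in the certificate makes the slow series sum to 2G.\<close>
  have "(\<lambda>n. 1 / (2 * (2 * real n + 2 * real 0 + 1)) * V 0 n) sums
      (\<Sum>j. (real 0 + 2 * real j + 1) / ((2 * real 0 + 2 * real j + 1) * (2 * real j + 1)) * V j 0)"
    by (rule WZ_sums(2)[OF V_WZ lim bound summable_inverse_odd_squares r_tendsto_0])
  moreover have "(real 0 + 2 * real j + 1) / ((2 * real 0 + 2 * real j + 1) * (2 * real j + 1)) * V j 0
      = (-1) ^ j / (2 * real j + 1)\<^sup>2" for j
    by (simp add: V_0_right power2_eq_square)
  ultimately show ?thesis
    by (simp add: V_0_left catalan_constant_def)
qed

section \<open>Combining both evaluations of the slow series\<close>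

theorem theorem1:
  shows "summable (\<lambda>n. (-1) ^ n * ((3 * real n + 2) * 8 ^ n)
             / ((2 * real n + 1) ^ 3 * real ((2 * n) choose n) ^ 3)) \<and>
         catalan_constant =
           1 / 2 * (\<Sum>n. (-1) ^ n * ((3 * real n + 2) * 8 ^ n)
             / ((2 * real n + 1) ^ 3 * real ((2 * n) choose n) ^ 3))"
proof -
  have "(-1) ^ n * ((3 * real n + 2) * 8 ^ n) / ((2 * real n + 1) ^ 3 * real ((2 * n) choose n) ^ 3)
      = (3 * real n + 2) * B n 0" for n
  proof -
    \<comment> \<open>Cubing 4^n in \<open>r_central_binomial\<close> turns the base -1/8 into
      -8.\<close>
    have "(-1/8 :: real) ^ n * (4 ^ n) ^ 3 = ((-1/8) * 4 ^ 3) ^ n"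
      by (simp only: power_mult_distrib power_mult[symmetric] mult.commute)
    also have "\<dots> = ((-1) * 8) ^ n"
      by simp
    also have "\<dots> = (-1) ^ n * 8 ^ n"
      by (rule power_mult_distrib)
    finally show ?thesis
      by (simp add: B_0_right r_central_binomial power_divide power_mult_distrib)
  qed
  moreover have "catalan_constant = 1 / 2 * (\<Sum>n. (3 * real n + 2) * B n 0)"
    using sums_mult[OF B_sums(2), of "1/2"]
    by (intro sums_unique2[OF catalan_constant_sums_r]) (simp add: mult.commute)
  ultimately show ?thesis
    using B_sums(1) by simp
qed

end
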